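(* Let $B$ be an algebra over a field $K$ and let $\beta\in\mathrm{Mul}[[B]]$ with $\beta_0$ an invertible element of $\widetilde B$. Then the unsymmetrized T-transform $\widetilde T_\beta$ is the unique element of $\mathrm{Mul}[[B]]$ satisfying $$\big(\widetilde T_\beta\circ(I\beta)\big)(1+I\beta)=\beta.$$
   Context: $\widetilde B$ equals $B$ if $B$ has an identity element and the unitization of $B$ otherwise. $\mathrm{Mul}[[B]]$ is the set of sequences $\alpha=(\alpha_0,\alpha_1,\alpha_2,\ldots)$ with $\alpha_0\in\widetilde B$ and, for $n\ge1$, $\alpha_n:B\times\cdots\times B\to B$ an $n$-multilinear ($K$-multilinear) map. Addition is termwise. The formal product is $(\alpha\beta)_n(b_1,\ldots,b_n)=\sum_{k=0}^n\alpha_k(b_1,\ldots,b_k)\beta_{n-k}(b_{k+1},\ldots,b_n)$ (with $(\alpha\beta)_0=\alpha_0\beta_0$). If $\beta_0=0$, the formal composition $\alpha\circ\beta$ is given by $(\alpha\circ\beta)_0=\alpha_0$ and, for $n\ge1$, $$(\alpha\circ\beta)_n(b_1,\ldots,b_n)=\sum_{k=1}^n\ \sum_{\substack{p_1,\ldots,p_k\ge1 \\ p_1+\cdots+p_k=n}}\alpha_k\big(\beta_{p_1}(b_{q_1+1},\ldots,b_{q_1+p_1}),\ldots,\beta_{p_k}(b_{q_k+1},\ldots,b_{q_k+p_k})\big),$$ where $q_j=p_1+\cdots+p_{j-1}$ (so $q_1=0$). Put $1=(1,0,0,\ldots)$ (identity for the formal product) and $I=(0,\mathrm{id}_B,0,0,\ldots)$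 (identity for formal composition). $\alpha^{-1}$ denotes the inverse with respect to the formal product (it exists iff $\alpha_0$ is invertible in $\widetilde B$) and $\alpha^{\langle-1\rangle}$ the inverse with respect to formal composition (for $\alpha_0=0$ it exists iff $\alpha_1$ is an invertible linear map $B\to B$). For $\beta\in\mathrm{Mul}[[B]]$ with $\beta_0$ invertible, the unsymmetrized T-transform of $\beta$ is defined by $\widetilde T_\beta=\big(\beta\circ(I\beta)^{\langle-1\rangle}\big)(1+I)^{-1}$ (products are formal products). *)

theory Defs
  imports Complex_Main "HOL-Library.Product_Plus"
begin

text \<open>Algebras are associative and not assumed to be unital or commutative.\<close>

locale algebra_over = vector_space scale
  for scale :: "'k::field \<Rightarrow> 'b::ring \<Rightarrow> 'b" +
  assumes mult_scale_left: "scale s a * b = scale s (a * b)"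
    and mult_scale_right: "a * scale s b = scale s (a * b)"


text \<open>
  The unitization of \<open>B\<close> is \<open>K \<times> B\<close> with the product below, and \<open>B\<close> sits in it as the ideal
  \<open>{0} \<times> B\<close>. So that \<open>B~\<close> lives in one type in both cases, it is taken to be the
  copy \<open>{0} \<times> B\<close> of \<open>B\<close> if \<open>B\<close> has an identity element (the identity of \<open>B~\<close> is then \<open>(0, e)\<close>),
  and all of \<open>K \<times> B\<close> otherwise.
\<close>

definition is_identity :: "'b::ring \<Rightarrow> bool" where
  "is_identity e \<longleftrightarrow> (\<forall>x. e * x = x \<and> x * e = x)"

definition tilde_carrier :: "('k::field \<times> 'b::ring) set" where
  "tilde_carrier = (if \<exists>e::'b. is_identity e then {0} \<times> UNIV else UNIV)"

definition tilde_one :: "'k::field \<times> 'b::ring" where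
  "tilde_one = (if \<exists>e::'b. is_identity e then (0, THE e. is_identity e) else (1, 0))"

definition tilde_mult ::
  "('k::field \<Rightarrow> 'b::ring \<Rightarrow> 'b) \<Rightarrow> 'k \<times> 'b \<Rightarrow> 'k \<times> 'b \<Rightarrow> 'k \<times> 'b" where
  "tilde_mult scale x y =
     (fst x * fst y, scale (fst x) (snd y) + scale (fst y) (snd x) + snd x * snd y)"

definition tilde_invertible :: "('k::field \<Rightarrow> 'b::ring \<Rightarrow> 'b) \<Rightarrow> 'k \<times> 'b \<Rightarrow> bool" where
  "tilde_invertible scale x \<longleftrightarrow> x \<in> tilde_carrier \<and>
     (\<exists>y\<in>tilde_carrier. tilde_mult scale x y = tilde_one \<and> tilde_mult scale y x = tilde_one)"


text \<open>
  A sequence \<open>(\<alpha>\<^sub>0, \<alpha>\<^sub>1, \<alpha>\<^sub>2, \<dots>)\<close> is encoded as one function on lists: \<open>\<alpha> [] = \<alpha>\<^sub>0\<close> and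
  \<open>\<alpha> [b\<^sub>1, \<dots>, b\<^sub>n] = (0, \<alpha>\<^sub>n(b\<^sub>1, \<dots>, b\<^sub>n))\<close> for \<open>n \<ge> 1\<close>. This determines every \<open>\<alpha>\<^sub>n\<close>
  and is determined by them, so equality of functions is equality of sequences.
\<close>

type_synonym ('k, 'b) series = "'b list \<Rightarrow> 'k \<times> 'b"

definition Mul :: "('k::field \<Rightarrow> 'b::ring \<Rightarrow> 'b) \<Rightarrow> ('k, 'b) series set" where
  "Mul scale = {\<alpha>. \<alpha> [] \<in> tilde_carrier \<and>
     (\<forall>bs. bs \<noteq> [] \<longrightarrow> fst (\<alpha> bs) = 0) \<and>
     (\<forall>bs i. i < length bs \<longrightarrow> Vector_Spaces.linear scale scale (\<lambda>x. snd (\<alpha> (bs[i := x]))))}"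

definition series_add ::
  "('k::field, 'b::ring) series \<Rightarrow> ('k, 'b) series \<Rightarrow> ('k, 'b) series" where
  "series_add \<alpha> \<beta> bs = \<alpha> bs + \<beta> bs"

definition series_mult ::
  "('k::field \<Rightarrow> 'b::ring \<Rightarrow> 'b) \<Rightarrow> ('k, 'b) series \<Rightarrow> ('k, 'b) series \<Rightarrow> ('k, 'b) series" where
  "series_mult scale \<alpha> \<beta> bs = (\<Sum>k=0..length bs. tilde_mult scale (\<alpha> (take k bs)) (\<beta> (drop k bs)))"

definition compositions :: "nat \<Rightarrow> nat \<Rightarrow> nat list set" where
  "compositions n k = {ps. length ps = k \<and> (\<forall>p\<in>set ps. p \<ge> 1) \<and> sum_list ps = n}"

text \<open>With \<open>ps\<close> and \<open>j\<close> indexed from 0, \<open>sum_list (take j ps)\<close> is the offset \<open>q\<^sub>j\<^sub>+\<^sub>1\<close>.\<close>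

definition block :: "nat list \<Rightarrow> nat \<Rightarrow> 'b list \<Rightarrow> 'b list" where
  "block ps j bs = take (ps ! j) (drop (sum_list (take j ps)) bs)"

text \<open>Meaningful only when \<open>\<beta> [] = 0\<close>.\<close>

definition series_comp ::
  "('k::field, 'b::ring) series \<Rightarrow> ('k, 'b) series \<Rightarrow> ('k, 'b) series" where
  "series_comp \<alpha> \<beta> bs =
     (if bs = [] then \<alpha> []
      else \<Sum>k=1..length bs. \<Sum>ps\<in>compositions (length bs) k.
             \<alpha> (map (\<lambda>j. snd (\<beta> (block ps j bs))) [0..<k]))"

definition series_one :: "('k::field, 'b::ring) series" where
  "series_one bs = (if bs = [] then tilde_one else 0)"

definition series_id :: "('k::field, 'b::ring) series" where
  "series_id bs = (case bs of [b] \<Rightarrow> (0, b) | _ \<Rightarrow> 0)"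

definition mult_inverse ::
  "('k::field \<Rightarrow> 'b::ring \<Rightarrow> 'b) \<Rightarrow> ('k, 'b) series \<Rightarrow> ('k, 'b) series" where
  "mult_inverse scale \<alpha> = (THE \<gamma>. \<gamma> \<in> Mul scale \<and>
     series_mult scale \<alpha> \<gamma> = series_one \<and> series_mult scale \<gamma> \<alpha> = series_one)"

definition comp_inverse ::
  "('k::field \<Rightarrow> 'b::ring \<Rightarrow> 'b) \<Rightarrow> ('k, 'b) series \<Rightarrow> ('k, 'b) series" where
  "comp_inverse scale \<alpha> = (THE \<gamma>. \<gamma> \<in> Mul scale \<and> \<gamma> [] = 0 \<and>
     series_comp \<alpha> \<gamma> = series_id \<and> series_comp \<gamma> \<alpha> = series_id)"

definition unsym_T_transform ::
  "('k::field \<Rightarrow> 'b::ring \<Rightarrow> 'b) \<Rightarrow> ('k, 'b) series \<Rightarrow> ('k, 'b) series" where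
  "unsym_T_transform scale \<beta> =
     series_mult scale
       (series_comp \<beta> (comp_inverse scale (series_mult scale series_id \<beta>)))
       (mult_inverse scale (series_add series_one series_id))"

end

theory Submission
  imports Defs "HOL-Library.FuncSet"
begin

text \<open>
  Write \<open>\<phi> = I\<beta>\<close>. As \<open>(1 + I) \<circ> \<phi> = 1 + \<phi>\<close> and right composition with \<open>\<phi>\<close> is multiplicative
  (\<open>series_comp_mult\<close>), the equation for \<open>\<gamma>\<close> reads \<open>(\<gamma>(1 + I)) \<circ> \<phi> = \<beta>\<close>. Right composition with
  \<open>\<phi>\<close> and right multiplication by \<open>1 + I\<close> are both bijections of the series, so the equation has
  exactly one solution \<open>(\<beta> \<circ> \<phi>\<^sup>-\<^sup>1)(1 + I)\<^sup>-\<^sup>1\<close>, where \<open>\<phi>\<^sup>-\<^sup>1\<close> is the compositional inverse.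

  What this needs is associativity of both operations and the existence of the two inverses. The
  inverse of \<open>1 + I\<close> is the geometric series with terms \<open>(-1)\<^sup>n b\<^sub>1 \<cdots> b\<^sub>n\<close> (\<open>geometric_inverse\<close>). For
  \<open>\<phi>\<close>, the linear term \<open>b \<mapsto> b\<beta>\<^sub>0\<close> is invertible because \<open>\<beta>\<^sub>0\<close> is; a left inverse can then be
  solved for degree by degree, and as its own linear term is again invertible, it has a left inverse
  too, which forces it to be two-sided (\<open>comp_inverse_exists\<close>).

  All identities between the defining sums become changes of the index set once both operations are
  read as sums over ways of cutting the list of arguments: the product over cuts into two parts
  (\<open>series_mult_cuts\<close>), the composition over cuts into nonempty blocks (\<open>series_comp_splits\<close>).
  Associativity of composition is then the observation that cutting a list into blocks and grouping
  the blocks amounts to cutting it coarsely and refining each part (\<open>sum_nested_splits\<close>).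
\<close>

section \<open>Sums over factorizations of a list\<close>

definition cuts :: "'a list \<Rightarrow> ('a list \<times> 'a list) set" where
  "cuts bs = {(us, vs). us @ vs = bs}"

definition splits :: "'a list \<Rightarrow> 'a list list set" where
  "splits bs = {bss. concat bss = bs \<and> [] \<notin> set bss}"

lemma cuts_eq_image: "cuts bs = (\<lambda>k. (take k bs, drop k bs)) ` {0..length bs}"
proof -
  have "(us, vs) \<in> (\<lambda>k. (take k (us @ vs), drop k (us @ vs))) ` {0..length (us @ vs)}" for us vs :: "'a list"
    by (rule image_eqI[of _ _ "length us"]) auto
  then show ?thesis by (auto simp: cuts_def)
qed

lemma finite_cuts: "finite (cuts bs)"
  by (simp add: cuts_eq_image)

lemma cuts_Nil: "cuts [] = {([], [])}"
  by (auto simp: cuts_def)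

lemma cuts_Cons: "cuts (b # bs) = insert ([], b # bs) ((\<lambda>(us, vs). (b # us, vs)) ` cuts bs)"
  by (force simp: cuts_def Cons_eq_append_conv append_eq_Cons_conv)

lemma sum_cuts:
  "sum f (cuts bs) = (\<Sum>k=0..length bs. f (take k bs, drop k bs))"
proof -
  have "inj_on (\<lambda>k. (take k bs, drop k bs)) {0..length bs}"
    by (rule inj_on_inverseI[where g = "\<lambda>(us, vs). length us"]) auto
  then show ?thesis
    unfolding cuts_eq_image by (simp add: sum.reindex)
qed

lemma sum_cuts_Cons:
  "sum f (cuts (b # bs)) = f ([], b # bs) + (\<Sum>(us, vs)\<in>cuts bs. f (b # us, vs))"
proof -
  have "inj_on (\<lambda>(us, vs). (b # us, vs)) (cuts bs)" by (auto simp: inj_on_def)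
  moreover have "([], b # bs) \<notin> (\<lambda>(us, vs). (b # us, vs)) ` cuts bs" by auto
  ultimately show ?thesis
    unfolding cuts_Cons by (simp add: finite_cuts sum.reindex case_prod_unfold)
qed

text \<open>
  The cut falls behind or before the marked entry \<open>x\<close>. The index sets on the right do not
  mention \<open>x\<close>, so each summand can be examined separately for linearity in \<open>x\<close>.
\<close>

lemma sum_cuts_insert:
  "sum f (cuts (us @ x # vs)) =
     (\<Sum>(p, q)\<in>cuts vs. f (us @ x # p, q)) + (\<Sum>(p, q)\<in>cuts us. f (p, q @ x # vs))"
proof (induction us arbitrary: f)
  case Nil
  show ?case by (simp add: sum_cuts_Cons cuts_Nil add.commute)
next
  case (Cons u us)
  show ?case
    by (simp add: sum_cuts_Cons Cons.IH case_prod_unfold ac_simps)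
qed

lemma sum_cuts_snoc:
  "sum f (cuts (bs @ [b])) = f (bs @ [b], []) + (\<Sum>(us, vs)\<in>cuts bs. f (us, vs @ [b]))"
  by (simp add: sum_cuts_insert cuts_Nil)

lemma splits_Nil: "splits [] = {[]}"
  by (auto simp: splits_def) (metis list.set_intros(1) neq_Nil_conv)

lemma splits_nonempty: "bss \<in> splits bs \<Longrightarrow> bs \<noteq> [] \<Longrightarrow> bss \<noteq> []"
  by (auto simp: splits_def)

lemma length_splits_le:
  assumes "bss \<in> splits bs" shows "length bss \<le> length bs"
proof -
  have "[] \<notin> set bss \<Longrightarrow> length bss \<le> length (concat bss)"
    by (induction bss) (auto simp: Suc_le_eq, metis add_le_mono length_greater_0_conv less_eq_Suc_le plus_1_eq_Suc One_nat_def)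
  then show ?thesis using assms by (auto simp: splits_def)
qed

lemma finite_splits: "finite (splits bs)"
proof -
  let ?A = "{us. set us \<subseteq> set bs \<and> length us \<le> length bs}"
  have "us \<in> set bss \<Longrightarrow> length us \<le> length (concat bss)" for us :: "'a list" and bss
    by (induction bss) auto
  then have "splits bs \<subseteq> {bss. set bss \<subseteq> ?A \<and> length bss \<le> length bs}"
    using length_splits_le by (fastforce simp: splits_def)
  moreover have "finite {bss. set bss \<subseteq> ?A \<and> length bss \<le> length bs}"
    by (intro finite_lists_length_le) simp
  ultimately show ?thesis by (rule finite_subset)
qed

lemma splits_full_length:
  assumes "bss \<in> splits bs" "length bss = length bs"
  shows "bss = map (\<lambda>b. [b]) bs"
  using assms
proof (induction bss arbitrary: bs)
  case Nil
  then show ?case by (simp add: splits_def)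
next
  case (Cons b bss)
  obtain x xs where b: "b = x # xs"
    using Cons.prems(1) by (cases b) (auto simp: splits_def)
  have "bss \<in> splits (concat bss)" using Cons.prems(1) by (auto simp: splits_def)
  from length_splits_le[OF this] have "xs = []" "length bss = length (concat bss)"
    using Cons.prems by (auto simp: splits_def b)
  then show ?case
    using Cons.IH[of "concat bss"] Cons.prems(1) by (auto simp: splits_def b)
qed

lemma singletons_in_splits: "map (\<lambda>b. [b]) bs \<in> splits bs"
  by (induction bs) (auto simp: splits_def)

lemma splits_decomp:
  "splits bs = insert (map (\<lambda>b. [b]) bs) {bss \<in> splits bs. length bss < length bs}"
  using singletons_in_splits splits_full_length length_splits_le
  by (fastforce simp: le_less)

text \<open>
  The finest splitting contributes the top-degree term of a composition; this is the term that a
  recursion for the compositional inverse solves for.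
\<close>

lemma sum_splits_decomp:
  "sum f (splits bs) =
     f (map (\<lambda>b. [b]) bs) + (\<Sum>bss | bss \<in> splits bs \<and> length bss < length bs. f bss)"
proof -
  have "map (\<lambda>b. [b]) bs \<notin> {bss \<in> splits bs. length bss < length bs}" by simp
  then show ?thesis
    by (subst splits_decomp) (simp add: finite_splits)
qed

lemma concat_eq_mapE:
  assumes "concat css = map f xs"
  obtains dss where "concat dss = xs" "css = map (map f) dss"
proof -
  have "\<exists>dss. concat dss = xs \<and> css = map (map f) dss"
    using assms
  proof (induction css arbitrary: xs)
    case Nil
    then show ?case by auto
  next
    case (Cons c css)
    then obtain us vs where "xs = us @ vs" "c = map f us" "concat css = map f vs"
      by (auto simp: append_eq_map_conv)
    moreover obtain dss where "concat dss = vs" "css = map (map f) dss"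
      using Cons.IH \<open>concat css = map f vs\<close> by blast
    ultimately show ?case by (intro exI[of _ "us # dss"]) simp
  qed
  then show ?thesis using that by blast
qed

lemma bij_betw_splits_map:
  "bij_betw (map (map f)) (splits xs) (splits (map f xs))"
proof (rule bij_betw_imageI)
  show "inj_on (map (map f)) (splits xs)"
  proof (rule inj_onI)
    fix dss ess assume "dss \<in> splits xs" "ess \<in> splits xs" and eq: "map (map f) dss = map (map f) ess"
    then have "concat dss = concat ess" by (simp add: splits_def)
    moreover have "concat dss = concat ess \<Longrightarrow> map (map f) dss = map (map f) ess \<Longrightarrow> dss = ess"
      by (induction dss arbitrary: ess)
        (auto simp: Cons_eq_map_conv, (metis append_eq_append_conv map_eq_imp_length_eq)+)
    ultimately show "dss = ess" using eq by blast
  qed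
  show "map (map f) ` splits xs = splits (map f xs)"
  proof
    show "splits (map f xs) \<subseteq> map (map f) ` splits xs"
    proof
      fix css assume css: "css \<in> splits (map f xs)"
      then obtain dss where "concat dss = xs" "css = map (map f) dss"
        by (auto simp: splits_def elim: concat_eq_mapE)
      then show "css \<in> map (map f) ` splits xs"
        using css by (force simp: splits_def)
    qed
  qed (auto simp: splits_def map_concat)
qed

text \<open>
  A splitting depends only on positions, so it can be transported along any map of the entries,
  injective or not.
\<close>

lemma sum_splits_map:
  "sum F (splits (map f xs)) = (\<Sum>dss\<in>splits xs. F (map (map f) dss))"
  using sum.reindex_bij_betw[OF bij_betw_splits_map, of F f xs] by simp


text \<open>
  The entry \<open>None\<close> marks one argument. It lies in exactly one block, so every other
  factor of a summand of a composition is constant in that argument.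
\<close>

lemma splits_optionE:
  assumes "dss \<in> splits (map Some us @ None # map Some vs)"
  obtains A p q B where
    "dss = map (map Some) A @ (map Some p @ None # map Some q) # map (map Some) B"
proof -
  have "None \<in> set (concat dss)" using assms by (simp add: splits_def)
  then obtain d where "d \<in> set dss" "None \<in> set d" by auto
  then obtain A B p q where dss: "dss = A @ (p @ None # q) # B"
    by (metis split_list)
  have "map Some us @ None # map Some vs = (concat A @ p) @ None # (q @ concat B)"
    using assms by (simp add: splits_def dss)
  then have "map Some us = concat A @ p" "map Some vs = q @ concat B"
    by (subst (asm) append_Cons_eq_iff; auto)+
  then obtain us1 p' vs1 q' where "concat A = map Some us1" "p = map Some p'"
      "concat B = map Some vs1" "q = map Some q'"
    by (auto simp: map_eq_append_conv)
  moreover from this obtain A' B' where "A = map (map Some) A'" "B = map (map Some) B'"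
    by (meson concat_eq_mapE)
  ultimately show ?thesis using that dss by blast
qed

section \<open>Product and composition as sums over factorizations\<close>

lemma map_block_Cons:
  "map (\<lambda>j. block (p # ps) j bs) [0..<length (p # ps)] =
     take p bs # map (\<lambda>j. block ps j (drop p bs)) [0..<length ps]"
proof -
  have "map (\<lambda>j. block (p # ps) j bs) [0..<Suc (length ps)] =
      block (p # ps) 0 bs # map (\<lambda>j. block (p # ps) (Suc j) bs) [0..<length ps]"
    by (simp add: upt_conv_Cons map_Suc_upt[symmetric] o_def del: upt_Suc)
  then show ?thesis by (simp add: block_def add.commute del: upt_Suc)
qed

text \<open>
  A splitting is determined by its block lengths, and any list of positive lengths with the right
  sum occurs.
\<close>

lemma bij_betw_compositions_splits:
  assumes "bs \<noteq> []"
  shows "bij_betw (\<lambda>ps. map (\<lambda>j. block ps j bs) [0..<length ps])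
           (\<Union>k\<in>{1..length bs}. compositions (length bs) k) (splits bs)"
proof (rule bij_betwI[where g = "map length"])
  have blocks: "concat (map (\<lambda>j. block ps j bs) [0..<length ps]) = bs \<and>
      map length (map (\<lambda>j. block ps j bs) [0..<length ps]) = ps" if "sum_list ps = length bs" for ps
    using that
  proof (induction ps arbitrary: bs)
    case (Cons p ps)
    then show ?case
      using Cons.IH[of "drop p bs"] unfolding map_block_Cons by (simp add: min_def)
  qed simp
  let ?b = "\<lambda>ps. map (\<lambda>j. block ps j bs) [0..<length ps]"
  show "map length (?b ps) = ps" if "ps \<in> (\<Union>k\<in>{1..length bs}. compositions (length bs) k)" for ps
    using that blocks[of ps] by (auto simp: compositions_def)
  show "?b \<in> (\<Union>k\<in>{1..length bs}. compositions (length bs) k) \<rightarrow> splits bs"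
  proof
    fix ps assume ps: "ps \<in> (\<Union>k\<in>{1..length bs}. compositions (length bs) k)"
    then have *: "concat (?b ps) = bs" "map length (?b ps) = ps"
      using blocks[of ps] by (auto simp: compositions_def)
    have "[] \<notin> set (?b ps)"
    proof
      assume "[] \<in> set (?b ps)"
      then have "0 \<in> set (map length (?b ps))" by (metis image_eqI list.size(3) set_map)
      then show False using ps unfolding * by (auto simp: compositions_def)
    qed
    then show "?b ps \<in> splits bs" using * by (simp add: splits_def)
  qed
  show "map length \<in> splits bs \<rightarrow> (\<Union>k\<in>{1..length bs}. compositions (length bs) k)"
  proof
    fix bss assume bss: "bss \<in> splits bs"
    then have "length bss \<in> {1..length bs}"
      using length_splits_le[OF bss] splits_nonempty[OF bss assms] by (simp add: Suc_le_eq)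
    moreover have "map length bss \<in> compositions (length bs) (length bss)"
      using bss by (auto simp: compositions_def splits_def length_concat Suc_le_eq)
    ultimately show "map length bss \<in> (\<Union>k\<in>{1..length bs}. compositions (length bs) k)"
      by blast
  qed
  have "map (\<lambda>j. block (map length bss) j (concat bss)) [0..<length bss] = bss" for bss :: "'a list list"
  proof (induction bss)
    case (Cons b bss)
    then show ?case
      using map_block_Cons[of "length b" "map length bss" "concat (b # bss)"] by simp
  qed simp
  then show "?b (map length bss) = bss" if "bss \<in> splits bs" for bss
    using that by (auto simp: splits_def)
qed

lemma finite_compositions: "finite (compositions n k)"
proof -
  have "compositions n k \<subseteq> {ps. set ps \<subseteq> {..n} \<and> length ps = k}"
    by (auto simp: compositions_def member_le_sum_list)
  then show ?thesis
    by (rule finite_subset) (intro finite_lists_length_eq finite_atMost)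
qed

lemma series_comp_splits:
  "series_comp \<alpha> \<beta> bs = (\<Sum>bss\<in>splits bs. \<alpha> (map (snd \<circ> \<beta>) bss))"
proof (cases "bs = []")
  case True
  then show ?thesis by (simp add: series_comp_def splits_Nil)
next
  case False
  let ?C = "compositions (length bs)"
  let ?b = "\<lambda>ps. map (\<lambda>j. block ps j bs) [0..<length ps]"
  have "series_comp \<alpha> \<beta> bs =
      (\<Sum>k=1..length bs. \<Sum>ps\<in>?C k. \<alpha> (map (snd \<circ> \<beta>) (?b ps)))"
    using False by (auto simp: series_comp_def compositions_def o_def intro!: sum.cong)
  also have "\<dots> = (\<Sum>ps\<in>(\<Union>k\<in>{1..length bs}. ?C k). \<alpha> (map (snd \<circ> \<beta>) (?b ps)))"
    by (subst sum.UNION_disjoint) (auto simp: finite_compositions, auto simp: compositions_def)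
  also have "\<dots> = (\<Sum>bss\<in>splits bs. \<alpha> (map (snd \<circ> \<beta>) bss))"
    by (rule sum.reindex_bij_betw[OF bij_betw_compositions_splits[OF False]])
  finally show ?thesis .
qed

lemma series_mult_cuts:
  "series_mult scale \<alpha> \<beta> bs = (\<Sum>(us, vs)\<in>cuts bs. tilde_mult scale (\<alpha> us) (\<beta> vs))"
  by (simp add: series_mult_def sum_cuts)

lemma finite_all2:
  assumes "\<And>b. finite (S b)"
  shows "finite {cs. list_all2 (\<lambda>c b. c \<in> S b) cs bs}"
proof (induction bs)
  case (Cons b bs)
  have "{cs. list_all2 (\<lambda>c b. c \<in> S b) cs (b # bs)} =
      (\<lambda>(c, cs). c # cs) ` (S b \<times> {cs. list_all2 (\<lambda>c b. c \<in> S b) cs bs})"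
    by (auto simp: list_all2_Cons2)
  then show ?case using Cons.IH assms by simp
qed simp

lemma concat_concat: "concat (concat xsss) = concat (map concat xsss)"
  by (induction xsss) auto

text \<open>
  Both sides run over triply nested lists \<open>dss\<close> with no empty part at any level that flatten to
  \<open>bs\<close>. On the left the intermediate splitting is \<open>concat dss\<close> (grouping the blocks), on the
  right it is \<open>map concat dss\<close> (refining the blocks); either one is recovered from \<open>dss\<close>.
\<close>

lemma sum_nested_splits:
  fixes F :: "'a list list list \<Rightarrow> 'c::comm_monoid_add"
  shows "(\<Sum>bss\<in>splits bs. \<Sum>dss\<in>splits bss. F dss) =
     (\<Sum>bss\<in>splits bs. \<Sum>dss | list_all2 (\<lambda>d b. d \<in> splits b) dss bss. F dss)"
proof -
  let ?D = "{dss. concat (concat dss) = bs \<and> [] \<notin> set (concat dss) \<and> [] \<notin> set dss}"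
  define N where "N = (\<lambda>bss::'a list list. {dss. list_all2 (\<lambda>d b. d \<in> splits b) dss bss})"
  have N: "dss \<in> N bss \<longleftrightarrow> bss = map concat dss \<and> [] \<notin> set (concat dss)" for dss bss
    unfolding N_def mem_Collect_eq
  proof (induction dss arbitrary: bss)
    case (Cons d dss)
    then show ?case by (cases bss) (auto simp: splits_def)
  qed auto
  have finite_N: "finite (N bss)" for bss
    unfolding N_def by (intro finite_all2 finite_splits)
  have "(\<Sum>bss\<in>splits bs. \<Sum>dss\<in>splits bss. F dss) = (\<Sum>(bss, dss)\<in>Sigma (splits bs) splits. F dss)"
    by (simp add: sum.Sigma finite_splits)
  also have "\<dots> = sum F ?D"
    by (rule sum.reindex_bij_witness[of _ "\<lambda>dss. (concat dss, dss)" snd]) (auto simp: splits_def)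
  also have "\<dots> = (\<Sum>(bss, dss)\<in>Sigma (splits bs) N. F dss)"
  proof (rule sum.reindex_bij_witness[of _ snd "\<lambda>dss. (map concat dss, dss)"])
    fix dss assume dss: "dss \<in> ?D"
    then have "[] \<notin> set (map concat dss)"
      by auto (metis last_in_set)
    moreover have "concat (map concat dss) = bs"
      using dss by (simp add: concat_concat)
    ultimately show "(map concat dss, dss) \<in> Sigma (splits bs) N"
      using dss by (simp add: N splits_def)
  next
    fix bss_dss assume "bss_dss \<in> Sigma (splits bs) N"
    then obtain bss dss where *: "bss_dss = (bss, dss)" "bss \<in> splits bs" "dss \<in> N bss"
      by auto
    then have "[] \<notin> set dss" by (force simp: N splits_def)
    then show "snd bss_dss \<in> ?D" using * by (simp add: N splits_def concat_concat)
  qed (auto simp: N)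
  also have "\<dots> = (\<Sum>bss\<in>splits bs. \<Sum>dss\<in>N bss. F dss)"
    by (simp add: sum.Sigma finite_splits finite_N)
  finally show ?thesis by (simp only: N_def)
qed

section \<open>The algebra of multilinear series\<close>

context algebra_over
begin

abbreviation tilde_prod (infixl "\<odot>" 70) where "x \<odot> y \<equiv> tilde_mult scale x y"
abbreviation series_prod (infixl "\<otimes>" 70) where "\<alpha> \<otimes> \<beta> \<equiv> series_mult scale \<alpha> \<beta>"
abbreviation series_compose (infixl "\<circ>\<circ>" 75) where "\<alpha> \<circ>\<circ> \<beta> \<equiv> series_comp \<alpha> \<beta>"
abbreviation "lin \<equiv> Vector_Spaces.linear scale scale"

lemma lin_iff:
  "lin f \<longleftrightarrow> (\<forall>x y. f (x + y) = f x + f y) \<and> (\<forall>c x. f (scale c x) = scale c (f x))"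
  by (simp add: linear_iff_module_hom module_hom_iff module_axioms vector_space_axioms)

lemma tilde_assoc: "(x \<odot> y) \<odot> z = x \<odot> (y \<odot> z)"
  by (simp add: tilde_mult_def scale_right_distrib algebra_simps mult_scale_left mult_scale_right)

lemma tilde_distrib_left: "x \<odot> (y + z) = x \<odot> y + x \<odot> z"
  by (simp add: tilde_mult_def scale_right_distrib scale_left_distrib algebra_simps)

lemma tilde_distrib_right: "(x + y) \<odot> z = x \<odot> z + y \<odot> z"
  by (simp add: tilde_mult_def scale_right_distrib scale_left_distrib algebra_simps)

lemma tilde_zero [simp]: "0 \<odot> x = 0" "x \<odot> 0 = 0"
  by (simp_all add: tilde_mult_def zero_prod_def)

lemma tilde_minus [simp]: "(- x) \<odot> y = - (x \<odot> y)" "x \<odot> (- y) = - (x \<odot> y)"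
  by (simp_all add: tilde_mult_def)

lemma tilde_sum_left: "sum f A \<odot> y = (\<Sum>a\<in>A. f a \<odot> y)"
  by (induction A rule: infinite_finite_induct) (simp_all add: tilde_distrib_right)

lemma tilde_sum_right: "x \<odot> sum f A = (\<Sum>a\<in>A. x \<odot> f a)"
  by (induction A rule: infinite_finite_induct) (simp_all add: tilde_distrib_left)

text \<open>
  If \<open>B\<close> has an identity \<open>e\<close>, multiplication by \<open>(0, e)\<close> annihilates the scalar component, so it
  fixes exactly the elements of the carrier.
\<close>

lemma tilde_one_mult:
  assumes "x \<in> tilde_carrier"
  shows "tilde_one \<odot> x = x" "x \<odot> tilde_one = x"
proof -
  have "tilde_one \<odot> x = x \<and> x \<odot> tilde_one = x"
  proof (cases "\<exists>e::'b. is_identity e")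
    case True
    then obtain e :: 'b where e: "is_identity e" by blast
    moreover have "e' = e" if "is_identity e'" for e'
      using that e unfolding is_identity_def by metis
    ultimately have "(THE e::'b. is_identity e) = e" by (rule the_equality)
    then have one: "(tilde_one :: 'k \<times> 'b) = (0, e)" and "fst x = 0"
      using True assms by (auto simp: tilde_one_def tilde_carrier_def)
    then show ?thesis
      using e by (auto simp: tilde_mult_def is_identity_def prod_eq_iff)
  next
    case False
    then have "(tilde_one :: 'k \<times> 'b) = (1, 0)" by (simp add: tilde_one_def)
    then show ?thesis
      by (simp add: tilde_mult_def prod_eq_iff)
  qed
  then show "tilde_one \<odot> x = x" "x \<odot> tilde_one = x" by auto
qed

lemma tilde_carrier_closed:
  "(0, b) \<in> (tilde_carrier :: ('k \<times> 'b) set)"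
  "(tilde_one :: 'k \<times> 'b) \<in> tilde_carrier"
  "x \<in> (tilde_carrier :: ('k \<times> 'b) set) \<Longrightarrow> y \<in> tilde_carrier \<Longrightarrow> x \<odot> y \<in> tilde_carrier"
  by (auto simp: tilde_carrier_def tilde_one_def tilde_mult_def split: if_splits)

lemma lin_add: "lin f \<Longrightarrow> lin g \<Longrightarrow> lin (\<lambda>x. f x + g x)"
  by (auto simp: lin_iff scale_right_distrib algebra_simps)

lemma lin_minus: "lin f \<Longrightarrow> lin (\<lambda>x. - f x)"
  by (auto simp: lin_iff)

lemma lin_sum: "(\<And>a. a \<in> A \<Longrightarrow> lin (f a)) \<Longrightarrow> lin (\<lambda>x. \<Sum>a\<in>A. f a x)"
  by (induction A rule: infinite_finite_induct) (auto simp: lin_add, auto simp: lin_iff)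

lemma lin_o: "lin f \<Longrightarrow> lin g \<Longrightarrow> lin (\<lambda>x. f (g x))"
  by (auto simp: lin_iff)

lemma lin_tilde:
  assumes "lin f"
  shows "lin (\<lambda>x. snd ((0, f x) \<odot> a))" "lin (\<lambda>x. snd (a \<odot> (0, f x)))"
  using assms
  by (auto simp: lin_iff tilde_mult_def scale_right_distrib algebra_simps mult_scale_left
      mult_scale_right mult.commute)

text \<open>
  Naming the varied argument by the lists before and after it is better suited to cutting arguments
  than naming its index.
\<close>

lemma Mul_iff:
  "\<alpha> \<in> Mul scale \<longleftrightarrow> \<alpha> [] \<in> tilde_carrier \<and> (\<forall>bs. bs \<noteq> [] \<longrightarrow> fst (\<alpha> bs) = 0) \<and>
     (\<forall>us vs. lin (\<lambda>x. snd (\<alpha> (us @ x # vs))))"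
proof -
  have "(\<forall>bs i. i < length bs \<longrightarrow> lin (\<lambda>x. snd (\<alpha> (bs[i := x])))) \<longleftrightarrow>
      (\<forall>us vs. lin (\<lambda>x. snd (\<alpha> (us @ x # vs))))"
  proof (intro iffI allI impI)
    fix us vs :: "'b list" assume *: "\<forall>bs i. i < length bs \<longrightarrow> lin (\<lambda>x. snd (\<alpha> (bs[i := x])))"
    show "lin (\<lambda>x. snd (\<alpha> (us @ x # vs)))"
      using *[rule_format, of "length us" "us @ 0 # vs"] by simp
  next
    fix bs :: "'b list" and i :: nat assume "\<forall>us vs. lin (\<lambda>x. snd (\<alpha> (us @ x # vs)))" "i < length bs"
    then show "lin (\<lambda>x. snd (\<alpha> (bs[i := x])))"
      by (simp add: upd_conv_take_nth_drop)
  qed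
  then show ?thesis by (simp add: Mul_def)
qed

lemma Mul_fst: "\<alpha> \<in> Mul scale \<Longrightarrow> bs \<noteq> [] \<Longrightarrow> fst (\<alpha> bs) = 0"
  by (simp add: Mul_iff)

lemma Mul_lin: "\<alpha> \<in> Mul scale \<Longrightarrow> lin (\<lambda>x. snd (\<alpha> (us @ x # vs)))"
  by (simp add: Mul_iff)

lemma Mul_in_carrier: "\<alpha> \<in> Mul scale \<Longrightarrow> \<alpha> bs \<in> tilde_carrier"
  using tilde_carrier_closed(1)[of "snd (\<alpha> bs)"]
  by (cases "bs = []") (auto simp: Mul_iff, metis prod.collapse)

lemma Mul_insert_sum:
  assumes "\<alpha> \<in> Mul scale"
  shows "\<alpha> (us @ sum f A # vs) = (\<Sum>a\<in>A. \<alpha> (us @ f a # vs))"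
proof (rule prod_eqI)
  show "fst (\<alpha> (us @ sum f A # vs)) = fst (\<Sum>a\<in>A. \<alpha> (us @ f a # vs))"
    using assms by (simp add: Mul_fst fst_sum)
  let ?f = "\<lambda>x. snd (\<alpha> (us @ x # vs))"
  have add: "?f (x + y) = ?f x + ?f y" for x y
    using Mul_lin[OF assms, of us vs] by (simp add: lin_iff)
  from add[of 0 0] have "?f 0 = 0" by simp
  with add show "?f (sum f A) = snd (\<Sum>a\<in>A. \<alpha> (us @ f a # vs))"
    unfolding snd_sum by (induction A rule: infinite_finite_induct) simp_all
qed

lemma Mul_zero_entry:
  assumes "\<alpha> \<in> Mul scale" "0 \<in> set bs" shows "\<alpha> bs = 0"
proof -
  obtain us vs where "bs = us @ 0 # vs" using assms(2) by (meson split_list)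
  then show ?thesis using Mul_insert_sum[OF assms(1), of us "\<lambda>_. 0" "{}" vs] by simp
qed

lemma Mul_expand:
  assumes "\<alpha> \<in> Mul scale" and fin: "\<And>b. finite (S b)"
  shows "\<alpha> (us @ map (\<lambda>b. \<Sum>c\<in>S b. h c) bs) =
     (\<Sum>cs | list_all2 (\<lambda>c b. c \<in> S b) cs bs. \<alpha> (us @ map h cs))"
proof (induction bs arbitrary: us)
  case Nil
  then show ?case by simp
next
  case (Cons b bs)
  let ?L = "\<lambda>bs. {cs. list_all2 (\<lambda>c b. c \<in> S b) cs bs}"
  have "\<alpha> (us @ map (\<lambda>b. \<Sum>c\<in>S b. h c) (b # bs)) =
      (\<Sum>c\<in>S b. \<alpha> ((us @ [h c]) @ map (\<lambda>b. \<Sum>c\<in>S b. h c) bs))"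
    by (simp add: Mul_insert_sum[OF assms(1)])
  also have "\<dots> = (\<Sum>c\<in>S b. \<Sum>cs\<in>?L bs. \<alpha> (us @ map h (c # cs)))"
    unfolding Cons.IH by simp
  also have "\<dots> = (\<Sum>(c, cs)\<in>S b \<times> ?L bs. \<alpha> (us @ map h (c # cs)))"
    using fin by (subst sum.Sigma) (auto intro!: finite_all2)
  also have "\<dots> = (\<Sum>cs\<in>?L (b # bs). \<alpha> (us @ map h cs))"
    by (rule sum.reindex_bij_witness[of _ "\<lambda>cs. (hd cs, tl cs)" "\<lambda>(c, cs). c # cs"])
      (auto simp: list_all2_Cons2)
  finally show ?case .
qed

lemma series_mult_Mul:
  assumes \<alpha>: "\<alpha> \<in> Mul scale" and \<beta>: "\<beta> \<in> Mul scale"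
  shows "\<alpha> \<otimes> \<beta> \<in> Mul scale"
  unfolding Mul_iff
proof (intro conjI allI impI)
  show "(\<alpha> \<otimes> \<beta>) [] \<in> tilde_carrier"
    using assms by (simp add: series_mult_def tilde_carrier_closed Mul_in_carrier)
  fix bs :: "'b list" assume "bs \<noteq> []"
  then have "fst (\<alpha> us \<odot> \<beta> vs) = 0" if "(us, vs) \<in> cuts bs" for us vs
    using that assms Mul_fst[of \<alpha> us] Mul_fst[of \<beta> vs] by (auto simp: cuts_def tilde_mult_def)
  then show "fst ((\<alpha> \<otimes> \<beta>) bs) = 0"
    unfolding series_mult_cuts fst_sum by (intro sum.neutral) auto
next
  fix us vs :: "'b list"
  have "lin (\<lambda>x. snd (\<alpha> (us @ x # p) \<odot> \<beta> q))" for p q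
    using lin_tilde(1)[OF Mul_lin[OF \<alpha>, of us p], of "\<beta> q"] Mul_fst[OF \<alpha>, of "us @ _ # p"]
    by (simp add: tilde_mult_def)
  moreover have "lin (\<lambda>x. snd (\<alpha> p \<odot> \<beta> (q @ x # vs)))" for p q
    using lin_tilde(2)[OF Mul_lin[OF \<beta>, of q vs], of "\<alpha> p"] Mul_fst[OF \<beta>, of "q @ _ # vs"]
    by (simp add: tilde_mult_def)
  ultimately show "lin (\<lambda>x. snd ((\<alpha> \<otimes> \<beta>) (us @ x # vs)))"
    unfolding series_mult_cuts sum_cuts_insert
    by (simp add: snd_sum case_prod_unfold lin_add lin_sum)
qed

text \<open>
  Varying an argument varies the index set of splittings with it. Replacing that argument by a marker
  \<open>None\<close> fixes the index set, and in each summand the marker sits in one block only, so the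
  summand is a composite of two linear maps.
\<close>

lemma series_comp_Mul:
  assumes \<alpha>: "\<alpha> \<in> Mul scale" and \<beta>: "\<beta> \<in> Mul scale"
  shows "\<alpha> \<circ>\<circ> \<beta> \<in> Mul scale"
  unfolding Mul_iff
proof (intro conjI allI impI)
  show "(\<alpha> \<circ>\<circ> \<beta>) [] \<in> tilde_carrier"
    using \<alpha> by (simp add: series_comp_def Mul_in_carrier)
  fix bs :: "'b list" assume "bs \<noteq> []"
  then show "fst ((\<alpha> \<circ>\<circ> \<beta>) bs) = 0"
    unfolding series_comp_splits fst_sum
    using splits_nonempty by (intro sum.neutral) (auto intro!: Mul_fst[OF \<alpha>])
next
  fix us vs :: "'b list"
  let ?m = "map Some us @ None # map Some vs"
  let ?e = "\<lambda>x. case_option x id"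
  have "us @ x # vs = map (?e x) ?m" for x by (simp add: o_def)
  then have eq: "snd ((\<alpha> \<circ>\<circ> \<beta>) (us @ x # vs)) =
      (\<Sum>dss\<in>splits ?m. snd (\<alpha> (map (snd \<circ> \<beta>) (map (map (?e x)) dss))))" for x
    by (simp only: series_comp_splits sum_splits_map snd_sum)
  show "lin (\<lambda>x. snd ((\<alpha> \<circ>\<circ> \<beta>) (us @ x # vs)))"
    unfolding eq
  proof (rule lin_sum)
    fix dss assume "dss \<in> splits ?m"
    then obtain A p q B where dss:
      "dss = map (map Some) A @ (map Some p @ None # map Some q) # map (map Some) B"
      by (rule splits_optionE)
    have "map (snd \<circ> \<beta>) (map (map (?e x)) dss) =
        map (snd \<circ> \<beta>) A @ snd (\<beta> (p @ x # q)) # map (snd \<circ> \<beta>) B" for x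
      by (simp add: dss o_def)
    then show "lin (\<lambda>x. snd (\<alpha> (map (snd \<circ> \<beta>) (map (map (?e x)) dss))))"
      using lin_o[OF Mul_lin[OF \<alpha>] Mul_lin[OF \<beta>]] by simp
  qed
qed

lemma series_mult_assoc: "(\<alpha> \<otimes> \<beta>) \<otimes> \<gamma> = \<alpha> \<otimes> (\<beta> \<otimes> \<gamma>)"
proof
  fix bs
  have "((\<alpha> \<otimes> \<beta>) \<otimes> \<gamma>) bs =
      (\<Sum>((us, ws), (p, q))\<in>Sigma (cuts bs) (\<lambda>(us, ws). cuts us). \<alpha> p \<odot> (\<beta> q \<odot> \<gamma> ws))"
    by (subst sum.Sigma[symmetric])
      (auto simp: series_mult_cuts tilde_sum_left tilde_assoc finite_cuts case_prod_unfold)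
  also have "\<dots> =
      (\<Sum>((p, us), (q, ws))\<in>Sigma (cuts bs) (\<lambda>(p, us). cuts us). \<alpha> p \<odot> (\<beta> q \<odot> \<gamma> ws))"
    by (rule sum.reindex_bij_witness[of _
          "\<lambda>((p, us), (q, ws)). ((p @ q, ws), (p, q))"
          "\<lambda>((us, ws), (p, q)). ((p, q @ ws), (q, ws))"])
      (auto simp: cuts_def)
  also have "\<dots> = (\<alpha> \<otimes> (\<beta> \<otimes> \<gamma>)) bs"
    by (subst sum.Sigma[symmetric])
      (auto simp: series_mult_cuts tilde_sum_right finite_cuts case_prod_unfold)
  finally show "((\<alpha> \<otimes> \<beta>) \<otimes> \<gamma>) bs = (\<alpha> \<otimes> (\<beta> \<otimes> \<gamma>)) bs" .
qed

lemma series_one_Mul: "series_one \<in> Mul scale"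
  by (auto simp: Mul_iff series_one_def tilde_carrier_closed lin_iff)

lemma series_id_Mul: "series_id \<in> Mul scale"
  by (auto simp: Mul_iff series_id_def lin_iff zero_prod_def append_eq_Cons_conv Cons_eq_append_conv
      tilde_carrier_closed split: list.splits)

lemma series_add_Mul:
  assumes "\<alpha> \<in> Mul scale" "\<beta> \<in> Mul scale"
  shows "series_add \<alpha> \<beta> \<in> Mul scale"
proof -
  have "\<alpha> [] + \<beta> [] \<in> tilde_carrier"
    using assms by (auto simp: Mul_iff tilde_carrier_def split: if_splits)
  then show ?thesis
    using assms by (auto simp: Mul_iff series_add_def lin_add)
qed

lemma series_mult_one:
  assumes "\<alpha> \<in> Mul scale"
  shows "\<alpha> \<otimes> series_one = \<alpha>"
proof
  fix bs
  have "(\<alpha> \<otimes> series_one) bs = (\<Sum>(us, vs)\<in>{(bs, [])}. \<alpha> us \<odot> series_one vs)"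
    unfolding series_mult_cuts
    by (rule sum.mono_neutral_right) (auto simp: finite_cuts, auto simp: cuts_def series_one_def split: if_splits)
  then show "(\<alpha> \<otimes> series_one) bs = \<alpha> bs"
    using assms by (simp add: series_one_def tilde_one_mult Mul_in_carrier)
qed

lemma series_one_mult:
  assumes "\<alpha> \<in> Mul scale"
  shows "series_one \<otimes> \<alpha> = \<alpha>"
proof
  fix bs
  have "(series_one \<otimes> \<alpha>) bs = (\<Sum>(us, vs)\<in>{([], bs)}. series_one us \<odot> \<alpha> vs)"
    unfolding series_mult_cuts
    by (rule sum.mono_neutral_right) (auto simp: finite_cuts, auto simp: cuts_def series_one_def split: if_splits)
  then show "(series_one \<otimes> \<alpha>) bs = \<alpha> bs"
    using assms by (simp add: series_one_def tilde_one_mult Mul_in_carrier)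
qed

text \<open>
  Cutting a list of blocks into two lists of blocks is the same as cutting the underlying list in
  two and splitting both halves into blocks.
\<close>

lemma series_comp_mult: "(\<alpha> \<otimes> \<beta>) \<circ>\<circ> \<gamma> = (\<alpha> \<circ>\<circ> \<gamma>) \<otimes> (\<beta> \<circ>\<circ> \<gamma>)"
proof
  fix bs
  let ?g = "map (snd \<circ> \<gamma>)"
  have cuts_map: "cuts (map f xs) = (\<lambda>(us, vs). (map f us, map f vs)) ` cuts xs"
    "inj_on (\<lambda>(us, vs). (map f us, map f vs)) (cuts xs)" for f :: "'b list \<Rightarrow> 'b" and xs
     apply (auto simp: cuts_def inj_on_def append_eq_map_conv image_iff)
    by (metis append_eq_append_conv map_eq_imp_length_eq)+
  have "((\<alpha> \<otimes> \<beta>) \<circ>\<circ> \<gamma>) bs =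
      (\<Sum>bss\<in>splits bs. \<Sum>(us, vs)\<in>cuts bss. \<alpha> (?g us) \<odot> \<beta> (?g vs))"
    unfolding series_comp_splits series_mult_cuts cuts_map(1)
    by (subst sum.reindex[OF cuts_map(2)]) (simp add: case_prod_unfold)
  also have "\<dots> = (\<Sum>(bss, us, vs)\<in>Sigma (splits bs) cuts. \<alpha> (?g us) \<odot> \<beta> (?g vs))"
    by (rule sum.Sigma) (auto simp: finite_splits finite_cuts)
  also have "\<dots> = (\<Sum>((p, q), us, vs)\<in>Sigma (cuts bs) (\<lambda>(p, q). splits p \<times> splits q).
      \<alpha> (?g us) \<odot> \<beta> (?g vs))"
    by (rule sum.reindex_bij_witness[of _
          "\<lambda>((p, q), us, vs). (us @ vs, us, vs)"
          "\<lambda>(bss, us, vs). ((concat us, concat vs), us, vs)"])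
      (auto simp: cuts_def splits_def)
  also have "\<dots> = (\<Sum>(p, q)\<in>cuts bs. \<Sum>(us, vs)\<in>splits p \<times> splits q. \<alpha> (?g us) \<odot> \<beta> (?g vs))"
    by (simp add: sum.Sigma finite_splits finite_cuts case_prod_unfold)
  also have "\<dots> = ((\<alpha> \<circ>\<circ> \<gamma>) \<otimes> (\<beta> \<circ>\<circ> \<gamma>)) bs"
    unfolding series_comp_splits series_mult_cuts
    by (simp only: tilde_sum_left) (simp only: tilde_sum_right sum.cartesian_product)
  finally show "((\<alpha> \<otimes> \<beta>) \<circ>\<circ> \<gamma>) bs = ((\<alpha> \<circ>\<circ> \<gamma>) \<otimes> (\<beta> \<circ>\<circ> \<gamma>)) bs" .
qed

text \<open>
  Multilinearity of the outermost series pulls out the sums that the inner composition puts into its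
  arguments; the rest is the reindexing of nested splittings.
\<close>

lemma series_comp_assoc:
  assumes "\<alpha> \<in> Mul scale"
  shows "(\<alpha> \<circ>\<circ> \<beta>) \<circ>\<circ> \<gamma> = \<alpha> \<circ>\<circ> (\<beta> \<circ>\<circ> \<gamma>)"
proof
  fix bs
  let ?h = "\<lambda>d. snd (\<beta> (map (snd \<circ> \<gamma>) d))"
  have "((\<alpha> \<circ>\<circ> \<beta>) \<circ>\<circ> \<gamma>) bs = (\<Sum>bss\<in>splits bs. \<Sum>dss\<in>splits bss. \<alpha> (map ?h dss))"
    by (simp add: series_comp_splits sum_splits_map o_def)
  also have "\<dots> = (\<Sum>bss\<in>splits bs. \<Sum>dss | list_all2 (\<lambda>d b. d \<in> splits b) dss bss. \<alpha> (map ?h dss))"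
    by (rule sum_nested_splits)
  also have "\<dots> = (\<Sum>bss\<in>splits bs. \<alpha> (map (\<lambda>b. \<Sum>d\<in>splits b. ?h d) bss))"
    using Mul_expand[OF assms, where S = splits and us = "[]" and h = ?h]
    by (simp add: finite_splits)
  also have "\<dots> = (\<alpha> \<circ>\<circ> (\<beta> \<circ>\<circ> \<gamma>)) bs"
    by (simp add: series_comp_splits snd_sum o_def)
  finally show "((\<alpha> \<circ>\<circ> \<beta>) \<circ>\<circ> \<gamma>) bs = (\<alpha> \<circ>\<circ> (\<beta> \<circ>\<circ> \<gamma>)) bs" .
qed

lemma series_comp_add: "series_add \<alpha> \<beta> \<circ>\<circ> \<gamma> = series_add (\<alpha> \<circ>\<circ> \<gamma>) (\<beta> \<circ>\<circ> \<gamma>)"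
  by (simp add: fun_eq_iff series_comp_splits series_add_def sum.distrib)

lemma series_comp_one: "series_one \<circ>\<circ> \<gamma> = series_one"
proof
  fix bs
  show "(series_one \<circ>\<circ> \<gamma>) bs = series_one bs"
    using splits_nonempty[of _ bs]
    by (cases "bs = []") (auto simp: series_comp_splits series_one_def splits_Nil intro!: sum.neutral)
qed

text \<open>
  The identity series vanishes on every block of length other than one, and a multilinear map
  vanishes as soon as one argument does; only the finest splitting survives.
\<close>

lemma series_comp_id:
  assumes "\<alpha> \<in> Mul scale"
  shows "\<alpha> \<circ>\<circ> series_id = \<alpha>"
proof
  fix bs
  let ?I = "series_id :: ('k, 'b) series"
  have "\<alpha> (map (snd \<circ> ?I) bss) = 0"
    if bss: "bss \<in> splits bs" "length bss < length bs" for bss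
  proof (rule Mul_zero_entry[OF assms])
    obtain b where b: "b \<in> set bss" "length b \<noteq> 1"
    proof (rule ccontr)
      assume "\<not> thesis"
      with that have "map length bss = map (\<lambda>_. 1) bss" by auto
      then have "length (concat bss) = length bss" unfolding length_concat
        by (simp only:) (simp add: sum_list_triv)
      then show False using bss by (simp add: splits_def)
    qed
    have "?I b = 0" using b(2) by (auto simp: series_id_def split: list.splits)
    then show "0 \<in> set (map (snd \<circ> ?I) bss)"
      using b(1) by (force simp: image_iff)
  qed
  then have "(\<alpha> \<circ>\<circ> series_id) bs = \<alpha> (map (snd \<circ> ?I) (map (\<lambda>b. [b]) bs))"
    unfolding series_comp_splits sum_splits_decomp by simp
  also have "\<dots> = \<alpha> bs"
    by (simp add: series_id_def o_def)
  finally show "(\<alpha> \<circ>\<circ> series_id) bs = \<alpha> bs" .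
qed

lemma series_id_comp:
  assumes "\<alpha> \<in> Mul scale" "\<alpha> [] = 0"
  shows "series_id \<circ>\<circ> \<alpha> = \<alpha>"
proof
  fix bs
  show "(series_id \<circ>\<circ> \<alpha>) bs = \<alpha> bs"
  proof (cases "bs = []")
    case True
    then show ?thesis using assms by (simp add: series_comp_def series_id_def)
  next
    case False
    have "(series_id \<circ>\<circ> \<alpha>) bs = (\<Sum>bss\<in>{[bs]}. series_id (map (snd \<circ> \<alpha>) bss))"
      unfolding series_comp_splits
      by (rule sum.mono_neutral_right)
        (use False in \<open>simp add: finite_splits\<close>,
         use False in \<open>auto simp: series_id_def splits_def split: list.splits\<close>)
    also have "\<dots> = \<alpha> bs"
      using Mul_fst[OF assms(1) False] by (simp add: series_id_def prod_eq_iff)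
    finally show ?thesis .
  qed
qed

end

section \<open>Inverses\<close>

text \<open>
  The degree \<open>n\<close> part of \<open>\<delta> \<circ> \<gamma> = I\<close> reads \<open>\<delta>\<^sub>n(\<gamma>\<^sub>1 b\<^sub>1, \<dots>, \<gamma>\<^sub>1 b\<^sub>n)\<close> plus terms with \<open>\<delta>\<^sub>k\<close>,
  \<open>k < n\<close>. With \<open>g = \<gamma>\<^sub>1\<^sup>-\<^sup>1\<close>, evaluating at \<open>b\<^sub>i = g c\<^sub>i\<close> solves it for \<open>\<delta>\<^sub>n(c\<^sub>1, \<dots>, c\<^sub>n)\<close>.
\<close>

function comp_left_inverse ::
  "('b \<Rightarrow> 'b) \<Rightarrow> ('k::field, 'b::ring) series \<Rightarrow> ('k, 'b) series" where
  "comp_left_inverse g \<gamma> bs =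
     (if length bs \<le> 1 then series_id (map g bs)
      else - (\<Sum>bss | bss \<in> splits (map g bs) \<and> length bss < length bs.
                comp_left_inverse g \<gamma> (map (snd \<circ> \<gamma>) bss)))"
  by auto
termination
  by (relation "measure (\<lambda>(g, \<gamma>, bs). length bs)") auto

declare comp_left_inverse.simps [simp del]

text \<open>The series \<open>(1 + I)\<^sup>-\<^sup>1\<close>; its value on \<open>[b\<^sub>1, \<dots>, b\<^sub>n]\<close> is \<open>(-1)\<^sup>n b\<^sub>1 \<cdots> b\<^sub>n\<close>.\<close>

fun geometric_inverse ::
  "('k::field \<Rightarrow> 'b::ring \<Rightarrow> 'b) \<Rightarrow> ('k, 'b) series" where
  "geometric_inverse scale [] = tilde_one"
| "geometric_inverse scale (b # bs) = - tilde_mult scale (0, b) (geometric_inverse scale bs)"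

context algebra_over
begin

text \<open>
  By induction the series truncated below degree \<open>n\<close> is multilinear, and the recursion expresses
  degree \<open>n\<close> as a composition of this truncation with \<open>\<gamma>\<close>, evaluated at \<open>g\<close> of the arguments.
\<close>

lemma comp_left_inverse_Mul:
  assumes \<gamma>: "\<gamma> \<in> Mul scale" and g: "lin g"
  shows "comp_left_inverse g \<gamma> \<in> Mul scale"
proof -
  let ?\<delta> = "comp_left_inverse g \<gamma>"
  have fst0: "fst (?\<delta> bs) = 0" for bs
  proof (induction "length bs" arbitrary: bs rule: less_induct)
    case less
    show ?case
    proof (cases "length bs \<le> 1")
      case False
      then show ?thesis
        by (subst comp_left_inverse.simps) (simp add: fst_sum less sum.neutral)
    qed (auto simp: comp_left_inverse.simps series_id_def split: list.splits)
  qed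
  have lin: "lin (\<lambda>x. snd (?\<delta> (us @ x # vs)))" for us vs
  proof (induction "length us + length vs" arbitrary: us vs rule: less_induct)
    case less
    let ?n = "Suc (length us + length vs)"
    show ?case
    proof (cases "us = [] \<and> vs = []")
      case True
      then show ?thesis
        using g by (simp add: comp_left_inverse.simps series_id_def)
    next
      case False
      \<comment> \<open>truncation below the current degree, so that the induction hypothesis covers all of it\<close>
      let ?t = "\<lambda>bs. if length bs < ?n then ?\<delta> bs else 0"
      have "?t [] \<in> tilde_carrier"
        using tilde_carrier_closed(1)[of 0]
        by (simp add: comp_left_inverse.simps series_id_def zero_prod_def)
      moreover have "lin (\<lambda>x. snd (?t (p @ x # q)))" for p q
      proof (cases "length p + length q < length us + length vs")
        case True
        then show ?thesis using less by simp
      qed (simp add: lin_iff)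
      ultimately have t: "?t \<in> Mul scale"
        using fst0 by (simp add: Mul_iff)
      have eq: "snd (?\<delta> (us @ x # vs)) = - snd ((?t \<circ>\<circ> \<gamma>) (map g us @ g x # map g vs))" for x
      proof -
        have "(?t \<circ>\<circ> \<gamma>) (map g us @ g x # map g vs) =
           (\<Sum>bss | bss \<in> splits (map g us @ g x # map g vs) \<and> length bss < ?n.
              ?\<delta> (map (snd \<circ> \<gamma>) bss))"
          unfolding series_comp_splits
          by (subst sum.inter_filter[symmetric]) (auto simp: finite_splits intro!: sum.cong)
        then show ?thesis
          using False by (subst comp_left_inverse.simps) auto
      qed
      show ?thesis
        unfolding eq by (intro lin_minus lin_o[OF Mul_lin[OF series_comp_Mul[OF t \<gamma>]] g])
    qed
  qed
  have "?\<delta> [] \<in> tilde_carrier"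
    using tilde_carrier_closed(1)[of 0]
    by (simp add: comp_left_inverse.simps series_id_def zero_prod_def)
  with fst0 lin show ?thesis by (simp add: Mul_iff)
qed

lemma comp_left_inverse_comp:
  assumes "\<And>b. g (snd (\<gamma> [b])) = b"
  shows "comp_left_inverse g \<gamma> \<circ>\<circ> \<gamma> = series_id"
proof
  fix bs
  let ?\<delta> = "comp_left_inverse g \<gamma>"
  let ?bs = "map (snd \<circ> \<gamma>) (map (\<lambda>b. [b]) bs)"
  let ?S = "\<Sum>bss | bss \<in> splits bs \<and> length bss < length bs. ?\<delta> (map (snd \<circ> \<gamma>) bss)"
  have g: "map g ?bs = bs" by (simp add: assms o_def)
  have comp: "(?\<delta> \<circ>\<circ> \<gamma>) bs = ?\<delta> ?bs + ?S"
    unfolding series_comp_splits sum_splits_decomp ..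
  show "(?\<delta> \<circ>\<circ> \<gamma>) bs = series_id bs"
  proof (cases "length bs \<le> 1")
    case True
    then have "?S = 0"
      using splits_nonempty[of "[]" bs] by (cases bs) (auto intro!: sum.neutral)
    moreover have "?\<delta> ?bs = series_id bs"
      using True g by (subst comp_left_inverse.simps) simp
    ultimately show ?thesis using comp by simp
  next
    case False
    then have "?\<delta> ?bs = - ?S"
      by (subst comp_left_inverse.simps) (use g in simp)
    moreover have "series_id bs = 0"
      using False by (auto simp: series_id_def split: list.splits)
    ultimately show ?thesis using comp by simp
  qed
qed

text \<open>
  A left inverse \<open>\<delta>\<close> of \<open>\<gamma>\<close> has linear term \<open>g\<close>, which is invertible, so \<open>\<delta>\<close> has a left inverse \<open>\<epsilon>\<close>.
  As in any monoid, \<open>\<epsilon> = \<epsilon> \<circ> (\<delta> \<circ> \<gamma>) = \<gamma>\<close>.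
\<close>

lemma comp_inverse_exists:
  assumes \<gamma>: "\<gamma> \<in> Mul scale" "\<gamma> [] = 0" and g: "lin g"
    and inv: "\<And>b. g (snd (\<gamma> [b])) = b" "\<And>b. snd (\<gamma> [g b]) = b"
  obtains \<delta> where "\<delta> \<in> Mul scale" "\<delta> [] = 0" "\<gamma> \<circ>\<circ> \<delta> = series_id" "\<delta> \<circ>\<circ> \<gamma> = series_id"
proof
  let ?c = "\<lambda>b. snd (\<gamma> [b])"
  let ?\<delta> = "comp_left_inverse g \<gamma>"
  let ?\<epsilon> = "comp_left_inverse ?c ?\<delta>"
  have c: "lin ?c" using Mul_lin[OF \<gamma>(1), of "[]" "[]"] by simp
  show \<delta>: "?\<delta> \<in> Mul scale" by (rule comp_left_inverse_Mul[OF \<gamma>(1) g])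
  show "?\<delta> [] = 0" by (simp add: comp_left_inverse.simps series_id_def)
  show left: "?\<delta> \<circ>\<circ> \<gamma> = series_id" by (rule comp_left_inverse_comp[OF inv(1)])
  have \<epsilon>: "?\<epsilon> \<in> Mul scale" by (rule comp_left_inverse_Mul[OF \<delta> c])
  have \<epsilon>\<delta>: "?\<epsilon> \<circ>\<circ> ?\<delta> = series_id"
    by (rule comp_left_inverse_comp) (simp add: comp_left_inverse.simps series_id_def inv)
  have "\<gamma> = (?\<epsilon> \<circ>\<circ> ?\<delta>) \<circ>\<circ> \<gamma>" by (simp add: \<epsilon>\<delta> series_id_comp[OF \<gamma>])
  also have "\<dots> = ?\<epsilon>" by (simp add: series_comp_assoc[OF \<epsilon>] left series_comp_id[OF \<epsilon>])
  finally show "\<gamma> \<circ>\<circ> ?\<delta> = series_id" using \<epsilon>\<delta> by simp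
qed

lemma comp_inverse_eq:
  assumes "\<gamma> \<in> Mul scale" "\<gamma> [] = 0" "\<delta> \<in> Mul scale" "\<delta> [] = 0"
    and "\<gamma> \<circ>\<circ> \<delta> = series_id" "\<delta> \<circ>\<circ> \<gamma> = series_id"
  shows "comp_inverse scale \<gamma> = \<delta>"
  unfolding comp_inverse_def
proof (rule the_equality)
  fix \<epsilon> assume \<epsilon>: "\<epsilon> \<in> Mul scale \<and> \<epsilon> [] = 0 \<and> \<gamma> \<circ>\<circ> \<epsilon> = series_id \<and> \<epsilon> \<circ>\<circ> \<gamma> = series_id"
  have "\<epsilon> = (\<delta> \<circ>\<circ> \<gamma>) \<circ>\<circ> \<epsilon>" using \<epsilon> assms by (simp add: series_id_comp)
  also have "\<dots> = \<delta>" using \<epsilon> assms by (subst series_comp_assoc) (auto simp: series_comp_id)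
  finally show "\<epsilon> = \<delta>" .
qed (use assms in simp)

lemma mult_inverse_eq:
  assumes "\<alpha> \<in> Mul scale" "\<gamma> \<in> Mul scale" "\<alpha> \<otimes> \<gamma> = series_one" "\<gamma> \<otimes> \<alpha> = series_one"
  shows "mult_inverse scale \<alpha> = \<gamma>"
  unfolding mult_inverse_def
proof (rule the_equality)
  fix \<delta> assume \<delta>: "\<delta> \<in> Mul scale \<and> \<alpha> \<otimes> \<delta> = series_one \<and> \<delta> \<otimes> \<alpha> = series_one"
  have "\<delta> = (\<gamma> \<otimes> \<alpha>) \<otimes> \<delta>" using \<delta> assms by (simp add: series_one_mult)
  also have "\<dots> = \<gamma>" using \<delta> assms by (subst series_mult_assoc) (auto simp: series_mult_one)
  finally show "\<delta> = \<gamma>" .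
qed (use assms in simp)

lemma series_id_mult_Cons: "(series_id \<otimes> \<beta>) (b # bs) = (0, b) \<odot> \<beta> bs"
proof -
  have "(\<Sum>(us, vs)\<in>cuts bs. series_id (b # us) \<odot> \<beta> vs) =
      (\<Sum>(us, vs)\<in>{([], bs)}. series_id (b # us) \<odot> \<beta> vs)"
    by (rule sum.mono_neutral_right)
      (auto simp: finite_cuts, auto simp: cuts_def series_id_def split: list.splits)
  then show ?thesis
    by (simp add: series_mult_cuts sum_cuts_Cons) (simp add: series_id_def)
qed

lemma series_mult_id_snoc: "(\<beta> \<otimes> series_id) (bs @ [b]) = \<beta> bs \<odot> (0, b)"
proof -
  have "(\<Sum>(us, vs)\<in>cuts bs. \<beta> us \<odot> series_id (vs @ [b])) =
      (\<Sum>(us, vs)\<in>{(bs, [])}. \<beta> us \<odot> series_id (vs @ [b]))"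
    by (rule sum.mono_neutral_right)
      (auto simp: finite_cuts, auto simp: cuts_def series_id_def append_eq_Cons_conv split: list.splits)
  then show ?thesis
    by (simp add: series_mult_cuts sum_cuts_snoc) (simp add: series_id_def)
qed

lemma series_mult_distrib:
  "\<alpha> \<otimes> series_add \<beta> \<gamma> = series_add (\<alpha> \<otimes> \<beta>) (\<alpha> \<otimes> \<gamma>)"
  "series_add \<beta> \<gamma> \<otimes> \<alpha> = series_add (\<beta> \<otimes> \<alpha>) (\<gamma> \<otimes> \<alpha>)"
  by (simp_all add: fun_eq_iff series_mult_def series_add_def tilde_distrib_left
      tilde_distrib_right sum.distrib)

lemma geometric_inverse_Mul: "geometric_inverse scale \<in> Mul scale"
proof -
  let ?J = "geometric_inverse scale"
  have fst0: "fst (?J (b # bs)) = 0" for b bs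
    by (simp add: tilde_mult_def)
  have "lin (\<lambda>x. snd (?J (us @ x # vs)))" for us vs
  proof (induction us)
    case Nil
    have "lin (\<lambda>x. x)" by (simp add: lin_iff)
    then show ?case by (simp add: lin_minus lin_tilde)
  next
    case (Cons u us)
    have "fst (?J (us @ x # vs)) = 0" for x
      using fst0 by (cases us) simp_all
    then show ?case
      using lin_minus[OF lin_tilde(2)[OF Cons.IH, of "(0, u)"]] by (simp add: tilde_mult_def)
  qed
  with fst0 show ?thesis
    unfolding Mul_iff by (auto simp: neq_Nil_conv tilde_carrier_closed)
qed

lemma geometric_inverse_snoc:
  "geometric_inverse scale (bs @ [b]) = - (geometric_inverse scale bs \<odot> (0, b))"
  by (induction bs) (simp_all add: tilde_one_mult tilde_carrier_closed tilde_assoc)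

lemma geometric_inverse:
  "series_add series_one series_id \<otimes> geometric_inverse scale = series_one"
  "geometric_inverse scale \<otimes> series_add series_one series_id = series_one"
proof -
  let ?J = "geometric_inverse scale"
  show "series_add series_one series_id \<otimes> ?J = series_one"
  proof
    fix bs
    show "(series_add series_one series_id \<otimes> ?J) bs = series_one bs"
      unfolding series_mult_distrib series_one_mult[OF geometric_inverse_Mul] series_add_def
      by (cases bs) (simp_all add: series_id_mult_Cons,
          simp_all add: series_mult_def series_id_def series_one_def)
  qed
  show "?J \<otimes> series_add series_one series_id = series_one"
  proof
    fix bs
    show "(?J \<otimes> series_add series_one series_id) bs = series_one bs"
      unfolding series_mult_distrib series_mult_one[OF geometric_inverse_Mul] series_add_def
      by (cases bs rule: rev_cases) (simp_all add: series_mult_id_snoc geometric_inverse_snoc,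
          simp_all add: series_mult_def series_id_def series_one_def)
  qed
qed

text \<open>
  The linear term of \<open>I\<beta>\<close> is right multiplication by \<open>\<beta>\<^sub>0\<close>, inverted by right multiplication by
  \<open>\<beta>\<^sub>0\<^sup>-\<^sup>1\<close>; both preserve \<open>B\<close> because it is an ideal of \<open>B~\<close>.
\<close>

lemma id_mult_comp_inverse:
  assumes \<beta>: "\<beta> \<in> Mul scale" and inv: "tilde_invertible scale (\<beta> [])"
  obtains \<psi> where "\<psi> \<in> Mul scale" "\<psi> [] = 0"
    "(series_id \<otimes> \<beta>) \<circ>\<circ> \<psi> = series_id" "\<psi> \<circ>\<circ> (series_id \<otimes> \<beta>) = series_id"
proof -
  obtain y where y: "\<beta> [] \<odot> y = tilde_one" "y \<odot> \<beta> [] = tilde_one"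
    using inv by (auto simp: tilde_invertible_def)
  let ?g = "\<lambda>b. snd ((0, b) \<odot> y)"
  have "lin (\<lambda>x. x)" by (simp add: lin_iff)
  then have g: "lin ?g" by (rule lin_tilde)
  have pair: "(0, snd ((0, b) \<odot> x)) = (0, b) \<odot> x" for b x
    by (simp add: tilde_mult_def)
  have "((0, b) \<odot> \<beta> []) \<odot> y = (0, b)" "((0, b) \<odot> y) \<odot> \<beta> [] = (0, b)" for b
    by (simp_all only: tilde_assoc y tilde_one_mult tilde_carrier_closed)
  then have "?g (snd ((series_id \<otimes> \<beta>) [b])) = b" "snd ((series_id \<otimes> \<beta>) [?g b]) = b" for b
    by (simp_all add: series_id_mult_Cons pair)
  moreover have "(series_id \<otimes> \<beta>) [] = 0"
    by (simp add: series_mult_def series_id_def)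
  ultimately show ?thesis
    using comp_inverse_exists[OF series_mult_Mul[OF series_id_Mul \<beta>] _ g] that by blast
qed

end

section \<open>The unsymmetrized T-transform\<close>

theorem proposition7p12:
  fixes scale :: "'k::field \<Rightarrow> 'b::ring \<Rightarrow> 'b"
    and \<beta> :: "('k, 'b) series"
  assumes "algebra_over scale"
    and "\<beta> \<in> Mul scale"
    and "tilde_invertible scale (\<beta> [])"
  shows "unsym_T_transform scale \<beta> \<in> Mul scale
    \<and> series_mult scale
        (series_comp (unsym_T_transform scale \<beta>) (series_mult scale series_id \<beta>))
        (series_add series_one (series_mult scale series_id \<beta>)) = \<beta>
    \<and> (\<forall>\<gamma>\<in>Mul scale.
         series_mult scale
           (series_comp \<gamma> (series_mult scale series_id \<beta>))
           (series_add series_one (series_mult scale series_id \<beta>)) = \<beta>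
         \<longrightarrow> \<gamma> = unsym_T_transform scale \<beta>)"
proof -
  interpret algebra_over scale by fact
  note \<beta> = assms(2)
  define \<phi> where "\<phi> = series_mult scale series_id \<beta>"
  have \<phi>: "\<phi> \<in> Mul scale" "\<phi> [] = 0"
    unfolding \<phi>_def
    by (rule series_mult_Mul[OF series_id_Mul \<beta>]) (simp add: series_mult_def series_id_def)
  obtain \<psi> where \<psi>: "\<psi> \<in> Mul scale" "\<psi> [] = 0"
      "\<phi> \<circ>\<circ> \<psi> = series_id" "\<psi> \<circ>\<circ> \<phi> = series_id"
    using id_mult_comp_inverse[OF \<beta> assms(3)] unfolding \<phi>_def by blast
  let ?u = "series_add series_one series_id :: ('k, 'b) series"
  let ?J = "geometric_inverse scale"
  let ?T = "unsym_T_transform scale \<beta>"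
  have u: "?u \<in> Mul scale"
    by (rule series_add_Mul[OF series_one_Mul series_id_Mul])
  note J = geometric_inverse_Mul geometric_inverse
  have T: "?T = (\<beta> \<circ>\<circ> \<psi>) \<otimes> ?J"
    unfolding unsym_T_transform_def \<phi>_def[symmetric]
    by (simp only: comp_inverse_eq[OF \<phi> \<psi>] mult_inverse_eq[OF u J])
  have T_Mul: "?T \<in> Mul scale"
    unfolding T by (intro series_mult_Mul series_comp_Mul \<beta> \<psi>(1) J(1))
  \<comment> \<open>reduces the equation of the theorem to one that is solved by inverting \<open>\<phi>\<close> and \<open>1 + I\<close>\<close>
  have factor: "(\<gamma> \<circ>\<circ> \<phi>) \<otimes> series_add series_one \<phi> = (\<gamma> \<otimes> ?u) \<circ>\<circ> \<phi>" for \<gamma>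
    by (simp add: series_comp_mult series_comp_add series_comp_one series_id_comp[OF \<phi>])
  have "?T \<otimes> ?u = \<beta> \<circ>\<circ> \<psi>"
    unfolding T series_mult_assoc J(3) by (rule series_mult_one[OF series_comp_Mul[OF \<beta> \<psi>(1)]])
  then have "(?T \<otimes> ?u) \<circ>\<circ> \<phi> = \<beta>"
    by (simp add: series_comp_assoc[OF \<beta>] \<psi> series_comp_id[OF \<beta>])
  moreover have "\<gamma> = ?T" if \<gamma>: "\<gamma> \<in> Mul scale" and eq: "(\<gamma> \<otimes> ?u) \<circ>\<circ> \<phi> = \<beta>" for \<gamma>
  proof -
    have \<gamma>u: "\<gamma> \<otimes> ?u \<in> Mul scale" by (rule series_mult_Mul[OF \<gamma> u])
    have "\<beta> \<circ>\<circ> \<psi> = \<gamma> \<otimes> ?u"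
      by (simp add: eq[symmetric] series_comp_assoc[OF \<gamma>u] \<psi> series_comp_id[OF \<gamma>u])
    then show ?thesis
      by (simp add: T series_mult_assoc J(2) series_mult_one[OF \<gamma>])
  qed
  ultimately show ?thesis
    using T_Mul unfolding \<phi>_def[symmetric] factor by blast
qed

end
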